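(* Let $K\ge 1$, $L\ge K+1$, and let problem $\mathrm{(P0)}$ be as defined in the context. Let $\mathrm{(P0\text{-}Eqv)}$ be the problem $$\text{minimize}\quad t_1^{off}+t_1^c+\sum_{k=1}^K t_k^{dl}$$ over $\boldsymbol{\Pi}=(\pi(l,k))\in\mathbb{R}^{L\times(K+1)}$, $\{t_k^{off},t_k^{dl},t_k^c\}_{k=1}^K$ and $t_0^c$, subject to all the constraints (a)--(h) of $\mathrm{(P0)}$ listed in the context, together with the additional constraints $$\sum_{k=1}^K t_k^{off}\le t_1^{off}+t_1^c,$$ $$t_k^c\le t_1^{off}+t_1^c+\sum_{j=1}^{k-1}t_j^{dl}-\sum_{j=1}^k t_j^{off},\qquad k=2,\dots,K,$$ $$t_0^c\le t_1^{off}+t_1^c+\sum_{k=1}^K t_k^{dl}.$$ Then $\mathrm{(P0)}$ and $\mathrm{(P0\text{-}Eqv)}$ are equivalent: they have the same optimal value (infimum, equal to $+\infty$ if infeasible), and every optimal solution of $\mathrm{(P0\text{-}Eqv)}$ is an optimal solution of $\mathrm{(P0)}$.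
   Context: Data: integers $K\ge1$ (number of helpers) and $L\ge K+1$ (number of tasks); for $l=1,\dots,L$ positive reals $T_l,R_l,C_l$; positive reals $B$, $E_0$, $\kappa_0$, $f_0^{\max}$, and for $k=1,\dots,K$ positive reals $E_k,\kappa_k,f_k^{\max},\bar h_k,\bar g_k$. Define $f(x)=2^{x/B}-1$. Variables: $\pi(l,k)$ for $l=1,\dots,L$, $k=1,\dots,K+1$ (task assignment; index $K+1$ is the local user), and times $t_k^{off},t_k^{dl},t_k^c$ ($k=1,\dots,K$) and $t_0^c$. An expression below with a positive numerator and a zero time in its denominator (e.g. $f(y/t)\,t$ with $y>0$, $t=0$) is taken to be $+\infty$, so feasible times are positive. Total latency: define recursively $$I_1=\max\Big\{t_1^{off}+t_1^c,\ \sum_{k=1}^K t_k^{off}\Big\},\qquad I_k=\max\Big\{\sum_{j=1}^k t_j^{off}+t_k^c,\ I_{k-1}+t_{k-1}^{dl}\Big\}\quad(k=2,\dots,K),$$ and $T^{\rm total}=\max\{t_0^c,\ I_K+t_K^{dl}\}$. Problem $\mathrm{(P0)}$: minimize $T^{\rm total}$ over all the variables subject to (a) $\kappa_0\dfrac{\left(\sum_{l=1}^L\pi(l,K+1)C_l\right)^3}{(t_0^c)^2}+\sum_{k=1}^K\dfrac{1}{\bar h_k}f\!\left(\dfrac{\sum_{l=1}^L\pi(l,k)T_l}{t_k^{off}}\right)t_k^{off}\le E_0$; (b) $\kappa_k\dfrac{\left(\sum_{l=1}^L\pi(l,k)C_l\right)^3}{(t_k^c)^2}+\dfrac{1}{\bar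 g_k}f\!\left(\dfrac{\sum_{l=1}^L\pi(l,k)R_l}{t_k^{dl}}\right)t_k^{dl}\le E_k$ for $k=1,\dots,K$; (c) $\dfrac{\sum_{l=1}^L\pi(l,K+1)C_l}{f_0^{\max}}\le t_0^c$; (d) $\dfrac{\sum_{l=1}^L\pi(l,k)C_l}{f_k^{\max}}\le t_k^c$ for $k=1,\dots,K$; (e) $\sum_{k=1}^{K+1}\pi(l,k)=1$ for $l=1,\dots,L$; (f) $\sum_{l=1}^L\pi(l,k)\ge1$ for $k=1,\dots,K+1$; (g) $\pi(l,k)\in\{0,1\}$ for all $l,k$; (h) $t_k^{off}\ge0$, $t_k^{dl}\ge0$ for $k=1,\dots,K$. *)

theory Defs
  imports Complex_Main "HOL-Library.Extended_Real"
begin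

text \<open>
  Helpers are indexed by \<open>1..K\<close> and tasks by \<open>1..L\<close>. In the fields \<open>energy\<close>, \<open>kappa\<close>, \<open>fmax\<close>
  and \<open>t_c\<close> the index \<open>0\<close> is the local user (\<open>E\<^sub>0\<close>, \<open>\<kappa>\<^sub>0\<close>, the maximal frequency of the user, and
  its computation time), whereas in the assignment \<open>assign l k\<close> the local user has index \<open>K + 1\<close>.
  Values of the fields outside these index ranges are never used.
\<close>

record offload_data =
  n_helpers :: nat                  \<comment> \<open>\<open>K\<close>\<close>
  n_tasks :: nat                    \<comment> \<open>\<open>L\<close>\<close>
  in_bits :: "nat \<Rightarrow> real"          \<comment> \<open>\<open>T\<^sub>l\<close>\<close>
  out_bits :: "nat \<Rightarrow> real"         \<comment> \<open>\<open>R\<^sub>l\<close>\<close>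
  cycles :: "nat \<Rightarrow> real"           \<comment> \<open>\<open>C\<^sub>l\<close>\<close>
  bandwidth :: real                 \<comment> \<open>\<open>B\<close>\<close>
  energy :: "nat \<Rightarrow> real"           \<comment> \<open>\<open>E\<^sub>k\<close>, including \<open>E\<^sub>0\<close>\<close>
  kappa :: "nat \<Rightarrow> real"            \<comment> \<open>\<open>\<kappa>\<^sub>k\<close>, including \<open>\<kappa>\<^sub>0\<close>\<close>
  fmax :: "nat \<Rightarrow> real"             \<comment> \<open>maximal frequencies, including that of the user\<close>
  gain_off :: "nat \<Rightarrow> real"         \<comment> \<open>the normalised gains \<open>h\<^sub>k\<close> (with bar)\<close>
  gain_dl :: "nat \<Rightarrow> real"          \<comment> \<open>the normalised gains \<open>g\<^sub>k\<close> (with bar)\<close>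

record offload_vars =
  assign :: "nat \<Rightarrow> nat \<Rightarrow> real"    \<comment> \<open>\<open>\<pi>(l,k)\<close>\<close>
  t_off :: "nat \<Rightarrow> real"
  t_dl :: "nat \<Rightarrow> real"
  t_c :: "nat \<Rightarrow> real"              \<comment> \<open>including the time of the user at index \<open>0\<close>\<close>

definition load :: "offload_data \<Rightarrow> offload_vars \<Rightarrow> (nat \<Rightarrow> real) \<Rightarrow> nat \<Rightarrow> real" where
  "load D x w k = (\<Sum>l=1..n_tasks D. assign x l k * w l)"

definition rate_fun :: "real \<Rightarrow> real \<Rightarrow> real" where
  "rate_fun B y = 2 powr (y / B) - 1"

text \<open>
  A positive numerator over a zero time counts as \<open>\<infinity>\<close>. The case of a non-positive numerator over a
  zero time (where division in HOL makes the value 0) does not occur at a point satisfying the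
  assignment constraints, since there every load is positive.
\<close>

definition comp_energy :: "real \<Rightarrow> real \<Rightarrow> real \<Rightarrow> ereal" where
  "comp_energy \<kappa> c t = (if t = 0 \<and> c > 0 then \<infinity> else ereal (\<kappa> * (c ^ 3 / t ^ 2)))"

definition trans_energy :: "real \<Rightarrow> real \<Rightarrow> real \<Rightarrow> real \<Rightarrow> ereal" where
  "trans_energy B gain y t =
     (if t = 0 \<and> y > 0 then \<infinity> else ereal (1 / gain * (rate_fun B (y / t) * t)))"

text \<open>The recursion for \<open>I\<^sub>k\<close> starts at \<open>k = 1\<close>; the value at \<open>0\<close> is a dummy.\<close>

fun latency :: "offload_data \<Rightarrow> offload_vars \<Rightarrow> nat \<Rightarrow> real" where
  "latency D x 0 = 0"
| "latency D x (Suc 0) = max (t_off x 1 + t_c x 1) (\<Sum>k=1..n_helpers D. t_off x k)"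
| "latency D x (Suc (Suc n)) =
     max ((\<Sum>j=1..Suc (Suc n). t_off x j) + t_c x (Suc (Suc n)))
         (latency D x (Suc n) + t_dl x (Suc n))"

definition total_latency :: "offload_data \<Rightarrow> offload_vars \<Rightarrow> real" where
  "total_latency D x = max (t_c x 0) (latency D x (n_helpers D) + t_dl x (n_helpers D))"

definition P0_feasible :: "offload_data \<Rightarrow> offload_vars set" where
  "P0_feasible D = {x. let K = n_helpers D; L = n_tasks D; B = bandwidth D in
     comp_energy (kappa D 0) (load D x (cycles D) (K + 1)) (t_c x 0)
       + (\<Sum>k=1..K. trans_energy B (gain_off D k) (load D x (in_bits D) k) (t_off x k))
       \<le> ereal (energy D 0) \<and>
     (\<forall>k\<in>{1..K}.
        comp_energy (kappa D k) (load D x (cycles D) k) (t_c x k)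
          + trans_energy B (gain_dl D k) (load D x (out_bits D) k) (t_dl x k)
          \<le> ereal (energy D k)) \<and>
     load D x (cycles D) (K + 1) / fmax D 0 \<le> t_c x 0 \<and>
     (\<forall>k\<in>{1..K}. load D x (cycles D) k / fmax D k \<le> t_c x k) \<and>
     (\<forall>l\<in>{1..L}. (\<Sum>k=1..K+1. assign x l k) = 1) \<and>
     (\<forall>k\<in>{1..K+1}. (\<Sum>l=1..L. assign x l k) \<ge> 1) \<and>
     (\<forall>l\<in>{1..L}. \<forall>k\<in>{1..K+1}. assign x l k \<in> {0, 1}) \<and>
     (\<forall>k\<in>{1..K}. t_off x k \<ge> 0 \<and> t_dl x k \<ge> 0)}"

definition P0Eqv_feasible :: "offload_data \<Rightarrow> offload_vars set" where
  "P0Eqv_feasible D = {x \<in> P0_feasible D. let K = n_helpers D in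
     (\<Sum>k=1..K. t_off x k) \<le> t_off x 1 + t_c x 1 \<and>
     (\<forall>k\<in>{2..K}. t_c x k \<le> t_off x 1 + t_c x 1 + (\<Sum>j=1..k-1. t_dl x j) - (\<Sum>j=1..k. t_off x j)) \<and>
     t_c x 0 \<le> t_off x 1 + t_c x 1 + (\<Sum>k=1..K. t_dl x k)}"

definition P0Eqv_objective :: "offload_data \<Rightarrow> offload_vars \<Rightarrow> real" where
  "P0Eqv_objective D x = t_off x 1 + t_c x 1 + (\<Sum>k=1..n_helpers D. t_dl x k)"

text \<open>In \<^typ>\<open>ereal\<close> the infimum over the empty set is \<open>\<infinity>\<close>.\<close>

definition opt_value :: "'a set \<Rightarrow> ('a \<Rightarrow> real) \<Rightarrow> ereal" where
  "opt_value S obj = (INF x\<in>S. ereal (obj x))"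

definition optimal_solution :: "'a set \<Rightarrow> ('a \<Rightarrow> real) \<Rightarrow> 'a \<Rightarrow> bool" where
  "optimal_solution S obj x \<longleftrightarrow> x \<in> S \<and> (\<forall>y\<in>S. obj x \<le> obj y)"

end

theory Submission imports Defs begin

text \<open>
  Both energy terms are nonincreasing in the time, so idle time can be absorbed for free. Given a
  feasible point of the original problem, prolong the computation of the first helper until \<open>I\<^sub>1\<close>,
  and the download of helper \<open>k\<close> until \<open>I\<^bsub>k+1\<^esub>\<close> (until the total latency if \<open>k = K\<close>).
  Every maximum in the recursion is then attained by \<open>t\<^sub>1\<^sup>o\<^sup>f\<^sup>f + t\<^sub>1\<^sup>c\<close> (for \<open>I\<^sub>1\<close>) or by the time
  at which the previous download ends, which is what the additional constraints say, and the
  objective of the new problem telescopes to the old total latency.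
  Conversely, the additional constraints resolve all the maxima, so on its feasible set the new
  objective is the total latency.
\<close>

lemma comp_energy_antimono:
  assumes "0 \<le> \<kappa>" "0 \<le> c" "0 \<le> s" "s \<le> t"
  shows "comp_energy \<kappa> c t \<le> comp_energy \<kappa> c s"
proof (cases "s = 0")
  case True
  then show ?thesis
    \<comment> \<open>For \<open>c > 0\<close> the right side is \<infinity>; for
      \<open>c = 0\<close> both sides are 0.\<close>
    using assms by (cases "c = 0") (auto simp: comp_energy_def)
next
  case False
  then have "c ^ 3 / t ^ 2 \<le> c ^ 3 / s ^ 2"
    using assms by (intro divide_left_mono power_mono mult_pos_pos) auto
  then have "\<kappa> * (c ^ 3 / t ^ 2) \<le> \<kappa> * (c ^ 3 / s ^ 2)"
    using assms by (intro mult_left_mono)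
  then show ?thesis
    using assms False by (simp add: comp_energy_def)
qed

text \<open>Averages the tangent bounds of \<open>exp\<close> at \<open>v\<close>, taken at the points \<open>r * v\<close> and \<open>0\<close>.\<close>

lemma exp_scaled_diff_le:
  fixes r v :: real
  assumes "1 \<le> r"
  shows "r * (exp v - 1) \<le> exp (r * v) - 1"
proof -
  have "exp v * (1 + (r - 1) * v) \<le> exp v * exp ((r - 1) * v)"
    by (intro mult_left_mono exp_ge_add_one_self) auto
  also have "\<dots> = exp (r * v)"
    by (simp add: algebra_simps flip: exp_add)
  finally have 1: "exp v * (1 + (r - 1) * v) \<le> exp (r * v)" .
  have "exp v * (1 + - v) \<le> exp v * exp (- v)"
    by (intro mult_left_mono exp_ge_add_one_self) auto
  also have "\<dots> = 1"
    by (simp flip: exp_add)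
  finally have "(r - 1) * (exp v * (1 + - v)) \<le> (r - 1) * 1"
    using assms by (intro mult_left_mono) auto
  with 1 show ?thesis
    by (simp add: algebra_simps)
qed

text \<open>\<open>rate_fun B\<close> is convex and vanishes at 0, so its perspective is
  nonincreasing in the time.\<close>

lemma rate_fun_perspective_antimono:
  assumes "0 < s" "s \<le> t"
  shows "rate_fun B (y / t) * t \<le> rate_fun B (y / s) * s"
proof -
  have exp: "rate_fun B z = exp (z / B * ln 2) - 1" for z
    by (simp add: rate_fun_def powr_def)
  \<comment> \<open>The ratio \<open>t / s\<close> scales the exponent belonging to \<open>t\<close>
    to the one belonging to \<open>s\<close>.\<close>
  have "t / s * (exp (y / t / B * ln 2) - 1) \<le> exp (t / s * (y / t / B * ln 2)) - 1"
    using assms by (intro exp_scaled_diff_le) auto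
  also have "t / s * (y / t / B * ln 2) = y / s / B * ln 2"
    using assms by auto
  finally show ?thesis
    using assms by (simp add: exp field_simps)
qed

lemma trans_energy_antimono:
  assumes "0 < gain" "0 \<le> y" "0 \<le> s" "s \<le> t"
  shows "trans_energy B gain y t \<le> trans_energy B gain y s"
proof (cases "s = 0")
  case True
  then show ?thesis
    using assms by (cases "y = 0") (auto simp: trans_energy_def rate_fun_def)
next
  case False
  then have "1 / gain * (rate_fun B (y / t) * t) \<le> 1 / gain * (rate_fun B (y / s) * s)"
    using assms by (intro mult_left_mono rate_fun_perspective_antimono) auto
  then show ?thesis
    using assms False by (simp add: trans_energy_def)
qed

lemma latency_Suc:
  assumes "1 \<le> n"
  shows "latency D x (Suc n) =
    max ((\<Sum>j=1..Suc n. t_off x j) + t_c x (Suc n)) (latency D x n + t_dl x n)"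
  using assms by (cases n) auto

lemma latency_ge_computation:
  assumes "1 \<le> k"
  shows "(\<Sum>j=1..k. t_off x j) + t_c x k \<le> latency D x k"
proof (cases "k = 1")
  case False
  with assms obtain n where "k = Suc n" "1 \<le> n"
    by (cases k) auto
  then show ?thesis by (simp add: latency_Suc del: sum.cl_ivl_Suc)
qed simp

lemma load_nonneg:
  assumes "\<forall>l\<in>{1..n_tasks D}. assign x l k \<in> {0, 1}" "\<forall>l\<in>{1..n_tasks D}. 0 < w l"
  shows "0 \<le> load D x w k"
  unfolding load_def
proof (rule sum_nonneg)
  fix l assume "l \<in> {1..n_tasks D}"
  with assms have "assign x l k \<in> {0, 1}" "0 < w l" by blast+
  then show "0 \<le> assign x l k * w l" by auto
qed

lemma total_latency_eq_objective:
  assumes K: "1 \<le> n_helpers D" and x: "x \<in> P0Eqv_feasible D"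
  shows "total_latency D x = P0Eqv_objective D x"
proof -
  let ?a = "t_off x 1 + t_c x 1"
  from x have off: "(\<Sum>k=1..n_helpers D. t_off x k) \<le> ?a"
    and comp: "\<And>k. k \<in> {2..n_helpers D} \<Longrightarrow>
      t_c x k \<le> ?a + (\<Sum>j=1..k-1. t_dl x j) - (\<Sum>j=1..k. t_off x j)"
    and user: "t_c x 0 \<le> ?a + (\<Sum>k=1..n_helpers D. t_dl x k)"
    by (auto simp: P0Eqv_feasible_def Let_def)
  \<comment> \<open>\<open>off\<close> settles the maximum at the first helper; at each later one,
    \<open>comp\<close> makes the end of the previous download the larger argument.\<close>
  have latency: "latency D x (Suc n) = ?a + (\<Sum>j=1..n. t_dl x j)" if "Suc n \<le> n_helpers D" for n
    using that
  proof (induction n)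
    case 0
    then show ?case using off by simp
  next
    case (Suc n)
    have "t_c x (Suc (Suc n)) \<le> ?a + (\<Sum>j=1..Suc n. t_dl x j) - (\<Sum>j=1..Suc (Suc n). t_off x j)"
      using comp[of "Suc (Suc n)"] Suc.prems by simp
    then show ?case
      using Suc by (simp add: max_def)
  qed
  obtain m where m: "n_helpers D = Suc m"
    using K by (cases "n_helpers D") auto
  show ?thesis
    using user latency[of m] by (simp add: total_latency_def P0Eqv_objective_def m max_def)
qed

text \<open>The user's energy constraint sees only \<open>t_off\<close> and the user's own
  computation time, both kept. In the helpers' constraints longer times lower the energies and
  preserve the lower bounds on the times.\<close>

lemma P0_feasible_prolong:
  assumes x: "x \<in> P0_feasible D"
    and w: "\<forall>l\<in>{1..n_tasks D}. 0 < out_bits D l \<and> 0 < cycles D l"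
    and pos: "\<forall>k\<in>{1..n_helpers D}. 0 < kappa D k \<and> 0 < fmax D k \<and> 0 < gain_dl D k"
    and c0: "c 0 = t_c x 0"
    and c: "\<And>k. k \<in> {1..n_helpers D} \<Longrightarrow> t_c x k \<le> c k"
    and d: "\<And>k. k \<in> {1..n_helpers D} \<Longrightarrow> t_dl x k \<le> d k"
  shows "x\<lparr>t_c := c, t_dl := d\<rparr> \<in> P0_feasible D"
proof -
  let ?y = "x\<lparr>t_c := c, t_dl := d\<rparr>"
  have load [simp]: "load D ?y = load D x"
    by (simp add: load_def fun_eq_iff)
  have helper: "comp_energy (kappa D k) (load D x (cycles D) k) (c k)
      + trans_energy (bandwidth D) (gain_dl D k) (load D x (out_bits D) k) (d k) \<le> ereal (energy D k)"
    "load D x (cycles D) k / fmax D k \<le> c k" "0 \<le> d k"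
    if k: "k \<in> {1..n_helpers D}" for k
  proof -
    have feas: "comp_energy (kappa D k) (load D x (cycles D) k) (t_c x k)
        + trans_energy (bandwidth D) (gain_dl D k) (load D x (out_bits D) k) (t_dl x k)
        \<le> ereal (energy D k)"
      "load D x (cycles D) k / fmax D k \<le> t_c x k" "0 \<le> t_dl x k"
      "\<forall>l\<in>{1..n_tasks D}. assign x l k \<in> {0, 1}"
      using x k by (auto simp: P0_feasible_def Let_def)
    have nonneg: "0 \<le> load D x (cycles D) k" "0 \<le> load D x (out_bits D) k"
      using feas(4) w by (auto intro!: load_nonneg)
    \<comment> \<open>Computation times have no explicit sign constraint; the frequency bound
      supplies the sign that \<open>comp_energy_antimono\<close> requires.\<close>
    have "0 \<le> load D x (cycles D) k / fmax D k"
      using nonneg(1) pos k by (intro divide_nonneg_pos) auto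
    with feas(2) have "0 \<le> t_c x k" by linarith
    then have "comp_energy (kappa D k) (load D x (cycles D) k) (c k)
        \<le> comp_energy (kappa D k) (load D x (cycles D) k) (t_c x k)"
      using pos k nonneg c[OF k] by (intro comp_energy_antimono) (auto intro: less_imp_le)
    moreover have "trans_energy (bandwidth D) (gain_dl D k) (load D x (out_bits D) k) (d k)
        \<le> trans_energy (bandwidth D) (gain_dl D k) (load D x (out_bits D) k) (t_dl x k)"
      using pos k nonneg feas(3) d[OF k] by (intro trans_energy_antimono) auto
    ultimately show "comp_energy (kappa D k) (load D x (cycles D) k) (c k)
        + trans_energy (bandwidth D) (gain_dl D k) (load D x (out_bits D) k) (d k)
        \<le> ereal (energy D k)"
      using feas(1) by (meson add_mono order_trans)
    show "load D x (cycles D) k / fmax D k \<le> c k" "0 \<le> d k"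
      using feas(2,3) c[OF k] d[OF k] by linarith+
  qed
  from x helper show ?thesis
    by (simp add: P0_feasible_def Let_def c0)
qed

lemma ex_P0Eqv_feasible:
  assumes K: "1 \<le> n_helpers D"
    and x: "x \<in> P0_feasible D"
    and w: "\<forall>l\<in>{1..n_tasks D}. 0 < out_bits D l \<and> 0 < cycles D l"
    and pos: "\<forall>k\<in>{1..n_helpers D}. 0 < kappa D k \<and> 0 < fmax D k \<and> 0 < gain_dl D k"
  shows "\<exists>y\<in>P0Eqv_feasible D. P0Eqv_objective D y = total_latency D x"
proof -
  let ?K = "n_helpers D"
  \<comment> \<open>Setting \<open>J (?K + 1)\<close> to the total latency lets the last download be
    prolonged by the same formula as the others.\<close>
  define J where "J k = (if k \<le> ?K then latency D x k else total_latency D x)" for k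
  define c where "c = (t_c x)(1 := J 1 - t_off x 1)"
  define d where "d k = J (Suc k) - J k" for k
  define y where "y = x\<lparr>t_c := c, t_dl := d\<rparr>"
  have sum_d: "(\<Sum>j=1..k. d j) = J (Suc k) - J 1" for k
    unfolding d_def by (induction k) auto
  have d_ge: "t_dl x k \<le> d k" if "k \<in> {1..?K}" for k
    using that by (cases "k = ?K") (auto simp: d_def J_def total_latency_def latency_Suc)
  \<comment> \<open>The first argument of the maximum gives \<open>t_x \<le> c\<close> at the first
    helper, in the sense \<open>t_c x 1 \<le> c 1\<close>; the second gives the additional
    constraint on the offloading times.\<close>
  have J1: "J 1 = max (t_off x 1 + t_c x 1) (\<Sum>k=1..?K. t_off x k)"
    using K by (simp add: J_def)
  have feasible: "y \<in> P0_feasible D"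
    unfolding y_def using x w pos _ _ d_ge
    by (rule P0_feasible_prolong) (use J1 in \<open>auto simp: c_def\<close>)
  \<comment> \<open>This is the additional constraint at \<open>y\<close>: there
    \<open>t_off x 1 + c 1 = J 1\<close>, and adding \<open>d\<close> up to \<open>k - 1\<close>
    telescopes to \<open>J k\<close>.\<close>
  have comp: "t_c x k \<le> J k - (\<Sum>j=1..k. t_off x j)" if "k \<in> {2..?K}" for k
    using latency_ge_computation[of k x D] that by (simp add: J_def)
  have "t_c x 0 \<le> J (Suc ?K)"
    by (simp add: J_def total_latency_def)
  with feasible comp have "y \<in> P0Eqv_feasible D"
    using J1 sum_d by (auto simp: P0Eqv_feasible_def Let_def y_def c_def)
  moreover have "P0Eqv_objective D y = total_latency D x"
    using sum_d by (simp add: P0Eqv_objective_def y_def c_def J_def)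
  ultimately show ?thesis ..
qed

text \<open>Infeasibility is covered too: for empty \<open>S\<close> the right side is
  \<infinity>.\<close>

lemma opt_value_le:
  assumes "\<And>x. x \<in> S \<Longrightarrow> \<exists>y\<in>T. g y \<le> f x"
  shows "opt_value T g \<le> opt_value S f"
  unfolding opt_value_def
  by (rule INF_mono) (use assms in auto)

theorem proposition3p1:
  fixes D :: offload_data
  assumes "n_helpers D \<ge> 1"
    and "n_tasks D \<ge> n_helpers D + 1"
    and "\<forall>l\<in>{1..n_tasks D}. in_bits D l > 0 \<and> out_bits D l > 0 \<and> cycles D l > 0"
    and "bandwidth D > 0"
    and "\<forall>k\<in>{0..n_helpers D}. energy D k > 0 \<and> kappa D k > 0 \<and> fmax D k > 0"
    and "\<forall>k\<in>{1..n_helpers D}. gain_off D k > 0 \<and> gain_dl D k > 0"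
  shows "opt_value (P0_feasible D) (total_latency D)
           = opt_value (P0Eqv_feasible D) (P0Eqv_objective D)
         \<and> (\<forall>x. optimal_solution (P0Eqv_feasible D) (P0Eqv_objective D) x
                \<longrightarrow> optimal_solution (P0_feasible D) (total_latency D) x)"
proof -
  note same = total_latency_eq_objective[OF assms(1)]
  have sub: "P0Eqv_feasible D \<subseteq> P0_feasible D"
    by (auto simp: P0Eqv_feasible_def)
  have ex: "\<exists>y\<in>P0Eqv_feasible D. P0Eqv_objective D y = total_latency D x"
    if "x \<in> P0_feasible D" for x
    using assms that by (intro ex_P0Eqv_feasible) auto
  have "opt_value (P0_feasible D) (total_latency D)
      = opt_value (P0Eqv_feasible D) (P0Eqv_objective D)"
  proof (rule antisym)
    show "opt_value (P0_feasible D) (total_latency D)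
        \<le> opt_value (P0Eqv_feasible D) (P0Eqv_objective D)"
      using same sub by (intro opt_value_le) (metis order_refl subsetD)
    show "opt_value (P0Eqv_feasible D) (P0Eqv_objective D)
        \<le> opt_value (P0_feasible D) (total_latency D)"
      using ex by (intro opt_value_le) (metis order_refl)
  qed
  moreover have "optimal_solution (P0_feasible D) (total_latency D) x"
    if "optimal_solution (P0Eqv_feasible D) (P0Eqv_objective D) x" for x
    \<comment> \<open>A competitor in \<open>P0_feasible D\<close> is replaced by a point of
      \<open>P0Eqv_feasible D\<close> whose objective is the competitor's total latency.\<close>
    using that same sub ex unfolding optimal_solution_def by (metis subsetD)
  ultimately show ?thesis by blast
qed

end
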